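(* Let $(X,\mathcal A)$ be a measurable space, $\mu$ a monotone measure on $\mathcal A$, and $A\in\mathcal A$. Let $\circ,\bullet\colon[0,\infty]\times[0,\infty]\to[0,\infty]$ be nondecreasing maps such that $a\circ0=a\bullet0=0$ for all $a$, and assume that $(a+b)\circ c\le(a\circ c)+(b\circ c)$ for all $a,b,c$. Let $H\colon[0,\infty)\to[0,\infty)$ and let $f\colon X\to[0,\infty)$ be such that $f$ and $H(f)=H\circ f$ are $\mathcal A$-measurable, and suppose that $p:=\int_{\bullet,A}f\,\mathrm d\mu<\infty$. If there exists $m_p\in\mathbb R$ such that $H(y)\le H(p)+m_p(y-p)$ for all $y\ge0$, then $$\int_{\circ,A}H(f)\,\mathrm d\mu\ \le\ \inf_{c\in\mathbb R}\Big\{\Big[\big(H(p)+m_p(c-p)\big)^+\circ\mu(A)\Big]+\int_{\circ,A}\big(m_p(f-c)\big)^+\,\mathrm d\mu\Big\}.$$ The bound is attainable, i.e. there are data satisfying these hypotheses for which equality holds.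
   Context: A monotone measure on $\mathcal A$ is a set function $\mu\colon\mathcal A\to[0,\infty]$ with $\mu(\emptyset)=0$ and $\mu(B)\le\mu(C)$ whenever $B\subset C$. A binary map $\circ$ is nondecreasing if $a\circ b\le c\circ d$ whenever $a\le c$ and $b\le d$. Notation: $a^+=\max(a,0)$. Generalized Sugeno integral: for a nondecreasing binary map $\circ$ and measurable $g\colon X\to[0,\infty]$, $$\int_{\circ,A}g\,\mathrm d\mu=\sup_{t\in[0,\infty]}\big\{t\circ\mu(A\cap\{g\ge t\})\big\},\qquad \{g\ge t\}=\{x\in X: g(x)\ge t\}.$$ *)

theory Defs
  imports "HOL-Analysis.Analysis"
begin

text \<open>
  The measurable space \<open>(X, \<A>)\<close> is given by \<open>space M\<close> and \<open>sets M\<close>; the measure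
  carried by \<open>M\<close> itself plays no role. A monotone measure is a separate set function \<open>\<mu>\<close>,
  constrained only on \<open>sets M\<close>. The extended half-line \<open>[0,\<infinity>]\<close> is the type \<open>ennreal\<close>.
\<close>

definition monotone_measure :: "'a measure \<Rightarrow> ('a set \<Rightarrow> ennreal) \<Rightarrow> bool" where
  "monotone_measure M \<mu> \<longleftrightarrow>
     \<mu> {} = 0 \<and> (\<forall>B\<in>sets M. \<forall>C\<in>sets M. B \<subseteq> C \<longrightarrow> \<mu> B \<le> \<mu> C)"

definition nondecreasing_op :: "(ennreal \<Rightarrow> ennreal \<Rightarrow> ennreal) \<Rightarrow> bool" where
  "nondecreasing_op opn \<longleftrightarrow> (\<forall>a b c d. a \<le> c \<longrightarrow> b \<le> d \<longrightarrow> opn a b \<le> opn c d)"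

definition gen_sugeno_integral ::
  "(ennreal \<Rightarrow> ennreal \<Rightarrow> ennreal) \<Rightarrow> 'a measure \<Rightarrow> ('a set \<Rightarrow> ennreal) \<Rightarrow> 'a set
     \<Rightarrow> ('a \<Rightarrow> ennreal) \<Rightarrow> ennreal" where
  "gen_sugeno_integral opn M \<mu> A g = (SUP t. opn t (\<mu> (A \<inter> {x \<in> space M. g x \<ge> t})))"

text \<open>
  Here \<open>opc\<close> is the operation of the integral in the inequality and \<open>opb\<close> the one defining \<open>p\<close>.
  Maps with domain or codomain \<open>[0,\<infinity>)\<close> are real-valued with explicit sign conditions;
  the values of \<open>H\<close> on negative arguments are irrelevant. As the integral is assumed
  finite, \<open>enn2real\<close> only retypes it.
\<close>

definition jensen_data ::
  "'a measure \<Rightarrow> ('a set \<Rightarrow> ennreal) \<Rightarrow> 'a set \<Rightarrow> (ennreal \<Rightarrow> ennreal \<Rightarrow> ennreal)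
     \<Rightarrow> (ennreal \<Rightarrow> ennreal \<Rightarrow> ennreal) \<Rightarrow> (real \<Rightarrow> real) \<Rightarrow> ('a \<Rightarrow> real) \<Rightarrow> real \<Rightarrow> real \<Rightarrow> bool"
where
  "jensen_data M \<mu> A opc opb H f p m \<longleftrightarrow>
     monotone_measure M \<mu> \<and> A \<in> sets M \<and>
     nondecreasing_op opc \<and> nondecreasing_op opb \<and>
     (\<forall>a. opc a 0 = 0) \<and> (\<forall>a. opb a 0 = 0) \<and>
     (\<forall>a b c. opc (a + b) c \<le> opc a c + opc b c) \<and>
     (\<forall>y\<ge>0. 0 \<le> H y) \<and> (\<forall>x\<in>space M. 0 \<le> f x) \<and>
     f \<in> borel_measurable M \<and> (\<lambda>x. H (f x)) \<in> borel_measurable M \<and>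
     gen_sugeno_integral opb M \<mu> A (\<lambda>x. ennreal (f x)) < \<infinity> \<and>
     p = enn2real (gen_sugeno_integral opb M \<mu> A (\<lambda>x. ennreal (f x))) \<and>
     (\<forall>y\<ge>0. H y \<le> H p + m * (y - p))"

end

theory Submission
  imports Defs
begin

text \<open>
  The supporting line gives \<open>H (f x) \<le> k + g x\<close> with \<open>k = (H p + m (c - p))\<^sup>+\<close> and
  \<open>g = (m (f - c))\<^sup>+\<close>, whatever \<open>c\<close> is. On the level set \<open>{H f \<ge> t}\<close> one then has \<open>g \<ge> t - k\<close>,
  so splitting \<open>t \<le> k + (t - k)\<close> and using subadditivity of the operation in its first argument
  bounds each term of the supremum. For \<open>H = id\<close> and \<open>m = 1\<close> the choice \<open>c = 0\<close> turns the
  bound into the integral of \<open>f\<close> itself, provided that the operation maps \<open>(0, \<mu> A)\<close> to \<open>0\<close>.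
\<close>

lemma gen_sugeno_integral_le_add:
  assumes \<mu>: "monotone_measure M \<mu>" and A: "A \<in> sets M" and opc: "nondecreasing_op opc"
    and sub: "\<And>a b c. opc (a + b) c \<le> opc a c + opc b c"
    and h: "h \<in> borel_measurable M" and g: "g \<in> borel_measurable M"
    and k: "k \<noteq> top" and le: "\<And>x. x \<in> space M \<Longrightarrow> h x \<le> k + g x"
  shows "gen_sugeno_integral opc M \<mu> A h \<le> opc k (\<mu> A) + gen_sugeno_integral opc M \<mu> A g"
  unfolding gen_sugeno_integral_def[of opc M \<mu> A h]
proof (rule SUP_least)
  fix t
  define B where "B = A \<inter> {x \<in> space M. h x \<ge> t}"
  define C where "C = A \<inter> {x \<in> space M. g x \<ge> t - k}"
  have [measurable]: "A \<in> sets M" "h \<in> borel_measurable M" "g \<in> borel_measurable M"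
    by fact+
  have B: "B \<in> sets M" and C: "C \<in> sets M"
    unfolding B_def C_def by measurable
  \<comment> \<open>In \<open>ennreal\<close> one has \<open>top - top = top\<close>, so
    \<open>t \<le> k + g x\<close> yields \<open>t - k \<le> g x\<close> for every \<open>t\<close>
    only because \<open>k\<close> is finite.\<close>
  have "t - k \<le> g x" if "x \<in> B" for x
    using that k le[of x] unfolding B_def by (auto simp: ennreal_minus_le_iff)
  then have "B \<subseteq> C"
    unfolding B_def C_def by auto
  then have BC: "\<mu> B \<le> \<mu> C" and BA: "\<mu> B \<le> \<mu> A"
    using \<mu> A B C unfolding monotone_measure_def B_def by auto
  have mono: "opc a b \<le> opc c d" if "a \<le> c" "b \<le> d" for a b c d
    using opc that unfolding nondecreasing_op_def by blast
  \<comment> \<open>Subtraction is truncated: for \<open>t < k\<close> the sum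
    \<open>k + (t - k)\<close> is \<open>k\<close>, so this is an inequality in general.\<close>
  have "opc t (\<mu> B) \<le> opc (k + (t - k)) (\<mu> B)"
    using k by (intro mono) (use ennreal_minus_le_iff[of t k "t - k"] in auto)
  also have "\<dots> \<le> opc k (\<mu> B) + opc (t - k) (\<mu> B)"
    by (rule sub)
  also have "\<dots> \<le> opc k (\<mu> A) + opc (t - k) (\<mu> C)"
    using BA BC by (intro add_mono mono) auto
  also have "opc (t - k) (\<mu> C) \<le> gen_sugeno_integral opc M \<mu> A g"
    unfolding gen_sugeno_integral_def C_def by (rule SUP_upper) simp
  finally show "opc t (\<mu> (A \<inter> {x \<in> space M. h x \<ge> t}))
      \<le> opc k (\<mu> A) + gen_sugeno_integral opc M \<mu> A g"
    unfolding B_def by (simp add: add_left_mono)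
qed

lemma jensen_bound:
  assumes "jensen_data M \<mu> A opc opb H f p m"
  shows "gen_sugeno_integral opc M \<mu> A (\<lambda>x. ennreal (H (f x)))
        \<le> (INF c::real. opc (ennreal (max (H p + m * (c - p)) 0)) (\<mu> A)
              + gen_sugeno_integral opc M \<mu> A (\<lambda>x. ennreal (max (m * (f x - c)) 0)))"
proof (rule INF_greatest, rule gen_sugeno_integral_le_add)
  fix c x
  note D = assms[unfolded jensen_data_def]
  have [measurable]: "f \<in> borel_measurable M" "(\<lambda>x. H (f x)) \<in> borel_measurable M"
    using D by auto
  show "(\<lambda>x. ennreal (H (f x))) \<in> borel_measurable M"
    "(\<lambda>x. ennreal (max (m * (f x - c)) 0)) \<in> borel_measurable M"
    by measurable
  assume "x \<in> space M"
  then have "H (f x) \<le> H p + m * (f x - p)"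
    using D by auto
  also have "\<dots> = (H p + m * (c - p)) + m * (f x - c)"
    by (simp add: algebra_simps)
  finally have "H (f x) \<le> max (H p + m * (c - p)) 0 + max (m * (f x - c)) 0"
    by linarith
  \<comment> \<open>The positive parts are nonnegative, so \<open>ennreal\<close> distributes over
    their sum.\<close>
  then show "ennreal (H (f x))
      \<le> ennreal (max (H p + m * (c - p)) 0) + ennreal (max (m * (f x - c)) 0)"
    by (simp add: ennreal_plus[symmetric] ennreal_leI del: ennreal_plus)
qed (use assms in \<open>auto simp: jensen_data_def\<close>)

lemma jensen_bound_attained:
  assumes D: "jensen_data M \<mu> A opc opb (\<lambda>y. y) f p 1" and 0: "opc 0 (\<mu> A) = 0"
  shows "gen_sugeno_integral opc M \<mu> A (\<lambda>x. ennreal (f x))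
        = (INF c::real. opc (ennreal (max (p + 1 * (c - p)) 0)) (\<mu> A)
              + gen_sugeno_integral opc M \<mu> A (\<lambda>x. ennreal (max (1 * (f x - c)) 0)))"
proof (rule antisym)
  \<comment> \<open>This holds outside \<open>space M\<close> too, as \<open>ennreal\<close> sends
    negative reals to 0.\<close>
  have "ennreal (max (f x) 0) = ennreal (f x)" for x
    by (simp add: max_def ennreal_neg)
  then show "(INF c::real. opc (ennreal (max (p + 1 * (c - p)) 0)) (\<mu> A)
              + gen_sugeno_integral opc M \<mu> A (\<lambda>x. ennreal (max (1 * (f x - c)) 0)))
      \<le> gen_sugeno_integral opc M \<mu> A (\<lambda>x. ennreal (f x))"
    using 0 by (intro INF_lower2[of 0]) auto
qed (rule jensen_bound[OF D])

text \<open>The operation \<open>min\<close> gives the classical Sugeno integral.\<close>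

lemma jensen_data_sugeno:
  obtains p where
    "jensen_data lborel (emeasure lborel) {0..1::real} min min (\<lambda>y. y) (\<lambda>x. \<bar>x\<bar>) p 1"
proof
  \<comment> \<open>Either both summands on the right are untruncated, or one of them already equals
    \<open>c\<close>.\<close>
  have sub: "min (a + b) c \<le> min a c + min b c" for a b c :: ennreal
  proof (cases "a \<le> c \<and> b \<le> c")
    case False
    then have "c \<le> min a c + min b c"
      by (auto simp: not_le min_def add_increasing add_increasing2)
    then show ?thesis
      by (rule min.coboundedI2)
  qed (simp add: min_absorb1 min.coboundedI1)
  have "gen_sugeno_integral min lborel (emeasure lborel) {0..1::real} (\<lambda>x. ennreal \<bar>x\<bar>)
      \<le> emeasure lborel {0..1::real}"
    unfolding gen_sugeno_integral_def
    by (intro SUP_least min.coboundedI2 emeasure_mono) auto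
  also have "\<dots> < \<infinity>"
    by simp
  \<comment> \<open>The value of the integral stays unevaluated: with slope 1 the line
    \<open>p + (y - p)\<close> is \<open>y\<close> whatever \<open>p\<close> is.\<close>
  finally show "jensen_data lborel (emeasure lborel) {0..1::real} min min (\<lambda>y. y) (\<lambda>x. \<bar>x\<bar>)
      (enn2real (gen_sugeno_integral min lborel (emeasure lborel) {0..1} (\<lambda>x. ennreal \<bar>x\<bar>))) 1"
    using sub unfolding jensen_data_def monotone_measure_def nondecreasing_op_def
    by (auto intro: emeasure_mono min.mono simp: min_def)
qed

theorem theorem3p1:
  "(\<forall>(M :: 'a measure) \<mu> A opc opb H f p m.
      jensen_data M \<mu> A opc opb H f p m \<longrightarrow>
        gen_sugeno_integral opc M \<mu> A (\<lambda>x. ennreal (H (f x)))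
        \<le> (INF c::real. opc (ennreal (max (H p + m * (c - p)) 0)) (\<mu> A)
              + gen_sugeno_integral opc M \<mu> A (\<lambda>x. ennreal (max (m * (f x - c)) 0))))
   \<and>
   (\<exists>(M :: real measure) \<mu> A opc opb H f p m.
      jensen_data M \<mu> A opc opb H f p m \<and>
        gen_sugeno_integral opc M \<mu> A (\<lambda>x. ennreal (H (f x)))
        = (INF c::real. opc (ennreal (max (H p + m * (c - p)) 0)) (\<mu> A)
              + gen_sugeno_integral opc M \<mu> A (\<lambda>x. ennreal (max (m * (f x - c)) 0))))"
proof (intro conjI allI impI)
  \<comment> \<open>The absolute value makes the integrand nonnegative on all of
    \<open>space lborel\<close>, the whole real line.\<close>
  obtain p where D:
    "jensen_data lborel (emeasure lborel) {0..1::real} min min (\<lambda>y. y) (\<lambda>x. \<bar>x\<bar>) p 1"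
    by (rule jensen_data_sugeno)
  show "\<exists>(M :: real measure) \<mu> A opc opb H f p m.
      jensen_data M \<mu> A opc opb H f p m \<and>
        gen_sugeno_integral opc M \<mu> A (\<lambda>x. ennreal (H (f x)))
        = (INF c::real. opc (ennreal (max (H p + m * (c - p)) 0)) (\<mu> A)
              + gen_sugeno_integral opc M \<mu> A (\<lambda>x. ennreal (max (m * (f x - c)) 0)))"
    by (intro exI conjI, rule D, rule jensen_bound_attained[OF D]) simp
qed (rule jensen_bound)

end
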